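(* Let $\mathcal{A}\subseteq\mathbb{N}^n$ be a finite set of powers, let $d=\deg(\mathcal{A})$, and let $K\subseteq\mathbb{R}^n$ be the semialgebraic set $K=\{x\in\mathbb{R}^n : c_i(x)=0\ (i\in\mathcal{E}),\ c_j(x)\ge 0\ (j\in\mathcal{I})\}$ defined by polynomials $c_i,c_j\in\mathbb{R}[x]$. Then: (i) The duality relations $$\mathscr{R}_{\mathcal{A}}(K)^*=\mathscr{P}_{\mathcal{A}}(K),\qquad \mathscr{P}_{\mathcal{A}}(K)^*=cl(\mathscr{R}_{\mathcal{A}}(K))$$ hold. If $K$ is compact and there exists $q\in\mathbb{R}[x]_{\mathcal{A}}$ such that $q>0$ on $K$, then $$int(\mathscr{P}_{\mathcal{A}}(K))=\{p\in\mathbb{R}[x]_{\mathcal{A}} : p|_K>0\},$$ and the moment cone $\mathscr{R}_{\mathcal{A}}(K)$ is closed. (ii) The subspace spanned by $\mathscr{R}_{\mathcal{A}}(K)$ is $$\mathrm{Span}\,\mathscr{R}_{\mathcal{A}}(K)=\{y\in\mathbb{R}^{\mathcal{A}} : \langle p,y\rangle=0\ \text{ for all } p\in I(K)_{\mathcal{A}}\},$$ or equivalently $\mathrm{Span}\,\mathscr{R}_{\mathcal{A}}(K)=I(K)_{\mathcal{A}}^{\perp}$. This implies that $$\dim\mathscr{R}_{\mathcal{A}}(K)=|\mathcal{A}|-\dim I(K)_{\mathcal{A}}.$$ Furthermore, the relative interior of $\mathscr{R}_{\mathcal{A}}(K)$ is $$ri(\mathscr{R}_{\mathcal{A}}(K))=\{y\in\mathbb{R}^{\mathcal{A}}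 : \mathscr{L}_y \text{ is strictly } K\text{-positive}\}.$$ In particular, if $I(K)_{\mathcal{A}}=\{0\}$, then $\mathscr{R}_{\mathcal{A}}(K)$ has nonempty interior.
   Context: Notation: $x=(x_1,\dots,x_n)$; for $\alpha\in\mathbb{N}^n$, $x^\alpha=x_1^{\alpha_1}\cdots x_n^{\alpha_n}$ and $|\alpha|=\alpha_1+\dots+\alpha_n$. $\mathcal{E},\mathcal{I}$ are finite label sets. For a finite $\mathcal{A}\subseteq\mathbb{N}^n$, $\deg(\mathcal{A})=\max\{|\alpha|:\alpha\in\mathcal{A}\}$; $\mathbb{R}^{\mathcal{A}}$ is the space of real vectors $y=(y_\alpha)_{\alpha\in\mathcal{A}}$; $\mathbb{R}[x]_{\mathcal{A}}$ is the span of the monomials $x^\alpha$, $\alpha\in\mathcal{A}$. For $p=\sum_{\alpha\in\mathcal{A}}p_\alpha x^\alpha$ and $y\in\mathbb{R}^{\mathcal{A}}$, $\langle p,y\rangle=\mathscr{L}_y(p)=\sum_{\alpha\in\mathcal{A}}p_\alpha y_\alpha$ ($\mathscr{L}_y$ is the Riesz functional). A $K$-representing measure of $y\in\mathbb{R}^{\mathcal{A}}$ is a positive Borel measure $\mu$ on $\mathbb{R}^n$ with support contained in $K$ and $y_\alpha=\int x^\alpha\,d\mu$ for all $\alpha\in\mathcal{A}$ (the zero measure, with empty support, is allowed). The truncated moment cone $\mathscr{R}_{\mathcal{A}}(K)$ is the set of all $y\in\mathbb{R}^{\mathcal{A}}$ having a $K$-representing measure. $\mathscr{P}_{\mathcal{A}}(K)=\{p\in\mathbb{R}[x]_{\mathcal{A}}: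 p(x)\ge 0\ \forall x\in K\}$. $I(K)_{\mathcal{A}}=\{p\in\mathbb{R}[x]_{\mathcal{A}}: p|_K\equiv 0\}$. $\mathscr{L}_y$ is strictly $K$-positive if $\mathscr{L}_y(p)>0$ for all $p\in\mathscr{P}_{\mathcal{A}}(K)$ with $p|_K\not\equiv 0$, and $\mathscr{L}_y(p)\ge 0$ for all $p\in\mathscr{P}_{\mathcal{A}}(K)$ (it is in particular $K$-positive). Dual cones are taken with respect to the pairing $\langle p,y\rangle$ between $\mathbb{R}[x]_{\mathcal{A}}$ and $\mathbb{R}^{\mathcal{A}}$: $S^*$ is the set of elements of the other space pairing nonnegatively with every element of $S$; $\perp$ is the annihilator for this pairing. $cl$, $int$, $ri$ denote closure, interior and relative interior in the Euclidean topology of the ambient space ($\mathbb{R}^{\mathcal{A}}$ or $\mathbb{R}[x]_{\mathcal{A}}$); $\dim$ of a convex set is the dimension of its affine hull. *)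

theory Defs
  imports "HOL-Analysis.Analysis" "HOL-Library.Poly_Mapping"
begin

type_synonym 'n exponent = "'n \<Rightarrow>\<^sub>0 nat"
type_synonym 'n mpoly = "'n exponent \<Rightarrow>\<^sub>0 real"

definition monomial :: "'n::finite exponent \<Rightarrow> real ^ 'n \<Rightarrow> real" where
  "monomial \<alpha> x = (\<Prod>j\<in>UNIV. (x $ j) ^ Poly_Mapping.lookup \<alpha> j)"

definition peval :: "'n::finite mpoly \<Rightarrow> real ^ 'n \<Rightarrow> real" where
  "peval p x = (\<Sum>\<alpha>\<in>Poly_Mapping.keys p. Poly_Mapping.lookup p \<alpha> * monomial \<alpha> x)"

definition exponent_degree :: "'n::finite exponent \<Rightarrow> nat" where
  "exponent_degree \<alpha> = (\<Sum>j\<in>UNIV. Poly_Mapping.lookup \<alpha> j)"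

definition powers_degree :: "'n::finite exponent set \<Rightarrow> nat" where
  "powers_degree A = Max (exponent_degree ` A)"

definition semialgebraic ::
    "('l \<Rightarrow> 'n::finite mpoly) \<Rightarrow> 'l set \<Rightarrow> 'l set \<Rightarrow> (real ^ 'n) set" where
  "semialgebraic c E I = {x. (\<forall>i\<in>E. peval (c i) x = 0) \<and> (\<forall>j\<in>I. peval (c j) x \<ge> 0)}"

text \<open>
  A set of powers \<open>A\<close> is given together with an enumeration \<open>e :: 'a \<Rightarrow> 'n exponent\<close>, a bijection
  from a finite type \<open>'a\<close> onto \<open>A\<close>. Both the space of real vectors indexed by \<open>A\<close> and the space of
  polynomials spanned by the monomials with exponents in \<open>A\<close> are then \<open>real ^ 'a\<close>, which supplies
  their Euclidean topology: component \<open>i\<close> of a vector \<open>y\<close> is the entry of \<open>y\<close> at \<open>e i\<close>, and component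
  \<open>i\<close> of a polynomial is its coefficient at \<open>e i\<close>. The polynomial with coefficient vector \<open>p\<close> is
  \<open>poly_of e p\<close>.
\<close>

definition poly_of :: "('a::finite \<Rightarrow> 'n::finite exponent) \<Rightarrow> real ^ 'a \<Rightarrow> 'n mpoly" where
  "poly_of e p = (\<Sum>i\<in>UNIV. Poly_Mapping.single (e i) (p $ i))"

lemma lookup_poly_of:
  assumes "inj e"
  shows "Poly_Mapping.lookup (poly_of e p) (e i) = p $ i"
proof -
  have "Poly_Mapping.lookup (poly_of e p) (e i) = (\<Sum>k\<in>UNIV. if k = i then p $ k else 0)"
    unfolding poly_of_def lookup_sum lookup_single
    using assms by (intro sum.cong) (auto simp: when_def inj_eq)
  then show ?thesis by simp
qed

lemma lookup_poly_of_notin: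
  assumes "\<alpha> \<notin> range e"
  shows "Poly_Mapping.lookup (poly_of e p) \<alpha> = 0"
  unfolding poly_of_def lookup_sum lookup_single
  using assms by (intro sum.neutral) (auto simp: when_def)

lemma bij_betw_poly_of:
  fixes e :: "'a::finite \<Rightarrow> 'n::finite exponent"
  assumes "bij_betw e UNIV A"
  shows "bij_betw (poly_of e) UNIV {f. Poly_Mapping.keys f \<subseteq> A}"
proof -
  have inj: "inj e" and A: "A = range e"
    using assms by (auto simp: bij_betw_def)
  show ?thesis
  proof (rule bij_betwI[where g = "\<lambda>f :: 'n mpoly. \<chi> i. Poly_Mapping.lookup f (e i)"])
    show "poly_of e \<in> UNIV \<rightarrow> {f. Poly_Mapping.keys f \<subseteq> A}"
      unfolding A using lookup_poly_of_notin by (metis (mono_tags) Pi_I in_keys_iff mem_Collect_eq subsetI)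
    fix f :: "'n mpoly" assume f: "f \<in> {f. Poly_Mapping.keys f \<subseteq> A}"
    show "poly_of e (\<chi> i. Poly_Mapping.lookup f (e i)) = f"
    proof (rule poly_mapping_eqI)
      fix \<alpha>
      show "Poly_Mapping.lookup (poly_of e (\<chi> i. Poly_Mapping.lookup f (e i))) \<alpha> = Poly_Mapping.lookup f \<alpha>"
      proof (cases "\<alpha> \<in> range e")
        case True
        then show ?thesis by (auto simp: lookup_poly_of[OF inj])
      next
        case False
        then have "Poly_Mapping.lookup f \<alpha> = 0" using f by (auto simp: A in_keys_iff)
        then show ?thesis using lookup_poly_of_notin[OF False] by simp
      qed
    qed
  qed (auto simp: lookup_poly_of[OF inj] vec_eq_iff)
qed

lemma peval_poly_of:
  assumes "inj e"
  shows "peval (poly_of e p) x = (\<Sum>i\<in>UNIV. p $ i * monomial (e i) x)"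
proof -
  have "Poly_Mapping.keys (poly_of e p) \<subseteq> range e"
    using lookup_poly_of_notin by (metis in_keys_iff subsetI)
  then have "peval (poly_of e p) x = (\<Sum>\<alpha>\<in>range e. Poly_Mapping.lookup (poly_of e p) \<alpha> * monomial \<alpha> x)"
    unfolding peval_def by (intro sum.mono_neutral_left) (auto simp: in_keys_iff)
  also have "\<dots> = (\<Sum>i\<in>UNIV. p $ i * monomial (e i) x)"
    using assms by (simp add: sum.reindex lookup_poly_of)
  finally show ?thesis .
qed

definition riesz :: "real ^ 'a::finite \<Rightarrow> real ^ 'a \<Rightarrow> real" where
  "riesz y p = (\<Sum>i\<in>UNIV. p $ i * y $ i)"

definition dual_of_vectors :: "(real ^ 'a::finite) set \<Rightarrow> (real ^ 'a) set" where
  "dual_of_vectors S = {p. \<forall>y\<in>S. riesz y p \<ge> 0}"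

definition dual_of_polys :: "(real ^ 'a::finite) set \<Rightarrow> (real ^ 'a) set" where
  "dual_of_polys S = {y. \<forall>p\<in>S. riesz y p \<ge> 0}"

definition annihilator_of_polys :: "(real ^ 'a::finite) set \<Rightarrow> (real ^ 'a) set" where
  "annihilator_of_polys S = {y. \<forall>p\<in>S. riesz y p = 0}"

definition measure_support :: "'b::topological_space measure \<Rightarrow> 'b set" where
  "measure_support \<mu> = {x. \<forall>U. open U \<and> x \<in> U \<longrightarrow> emeasure \<mu> U > 0}"

text \<open>
  The measure need not be finite. Integrability of the monomials is required explicitly because the
  Bochner integral of a non-integrable function is 0.
\<close>

definition representing_measure ::
    "('a::finite \<Rightarrow> 'n::finite exponent) \<Rightarrow> (real ^ 'n) set \<Rightarrow> real ^ 'a \<Rightarrow> (real ^ 'n) measure \<Rightarrow> bool"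
  where
  "representing_measure e K y \<mu> \<longleftrightarrow>
     sets \<mu> = sets borel \<and> measure_support \<mu> \<subseteq> K \<and>
     (\<forall>i. integrable \<mu> (monomial (e i)) \<and> y $ i = (\<integral>x. monomial (e i) x \<partial>\<mu>))"

definition moment_cone ::
    "('a::finite \<Rightarrow> 'n::finite exponent) \<Rightarrow> (real ^ 'n) set \<Rightarrow> (real ^ 'a) set" where
  "moment_cone e K = {y. \<exists>\<mu>. representing_measure e K y \<mu>}"

definition nonneg_polys ::
    "('a::finite \<Rightarrow> 'n::finite exponent) \<Rightarrow> (real ^ 'n) set \<Rightarrow> (real ^ 'a) set" where
  "nonneg_polys e K = {p. \<forall>x\<in>K. peval (poly_of e p) x \<ge> 0}"

definition vanishing_polys ::
    "('a::finite \<Rightarrow> 'n::finite exponent) \<Rightarrow> (real ^ 'n) set \<Rightarrow> (real ^ 'a) set" where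
  "vanishing_polys e K = {p. \<forall>x\<in>K. peval (poly_of e p) x = 0}"

definition strictly_positive ::
    "('a::finite \<Rightarrow> 'n::finite exponent) \<Rightarrow> (real ^ 'n) set \<Rightarrow> (real ^ 'a \<Rightarrow> real) \<Rightarrow> bool" where
  "strictly_positive e K L \<longleftrightarrow>
     (\<forall>p\<in>nonneg_polys e K. \<not> (\<forall>x\<in>K. peval (poly_of e p) x = 0) \<longrightarrow> L p > 0) \<and>
     (\<forall>p\<in>nonneg_polys e K. L p \<ge> 0)"

end

theory Submission
  imports Defs
begin

text \<open>
  Write \<open>M x\<close> for the vector of monomials \<open>x\<^sup>\<alpha>\<close>, \<open>\<alpha> \<in> A\<close>. Evaluation at \<open>x\<close> and the Riesz functional
  are both inner products: \<open>p(x) = p \<bullet> M x\<close> and \<open>L\<^sub>y(p) = p \<bullet> y\<close>. Let \<open>C\<close> be the convex cone generated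
  by \<open>M ` K\<close>. Everything rests on the inclusions \<open>C \<subseteq> R \<subseteq> closure C\<close> for the moment cone \<open>R\<close>: a conic
  combination of vectors \<open>M x\<close> with \<open>x \<in> K\<close> is represented by a finitely atomic measure on \<open>K\<close>
  (lemma \<open>atomic_subset_moment_cone\<close>), and the integral of \<open>M\<close> cannot be separated from \<open>C\<close> by a
  hyperplane, since integration over \<open>K\<close> preserves the sign of \<open>p \<bullet> M\<close>
  (lemma \<open>moment_cone_subset_closure\<close>). The equality \<open>R = C\<close> is used only when \<open>C\<close> is closed, where
  it follows from these inclusions.

  Consequently \<open>R\<close> and \<open>C\<close> have the same closure, the same span and, because \<open>C\<close> is convex, the same
  relative interior, so that only facts about the convex cone \<open>C\<close> remain. The dual cone of \<open>C\<close> is the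
  cone of polynomials that are nonnegative on \<open>K\<close>, and \<open>closure C\<close> is its bidual. The orthogonal
  complement of \<open>C\<close> consists of the polynomials that vanish on \<open>K\<close>, which gives span and dimension. A
  vector lies in the relative interior of \<open>C\<close> iff every element of the dual cone is nonnegative at it,
  and positive unless it vanishes on all of \<open>C\<close> (lemma \<open>rel_interior_convex_cone\<close>); this is strict
  \<open>K\<close>-positivity.

  If \<open>K\<close> is compact and \<open>q > 0\<close> on \<open>K\<close>, the hyperplane \<open>q \<bullet> y = 0\<close> does not meet the compact set
  \<open>convex hull (M ` K)\<close>, so that the cone \<open>C\<close> over it is closed and therefore equal to \<open>R\<close>. On \<open>K\<close>, a
  polynomial \<open>p\<close> in the interior of the nonnegative ones satisfies \<open>p \<ge> \<epsilon> q > 0\<close> for some \<open>\<epsilon> > 0\<close>; conversely,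
  a polynomial that is positive on \<open>K\<close> is bounded below there by a positive constant, and small changes
  of its coefficients keep it positive.
\<close>

section \<open>Convex cones in Euclidean spaces\<close>

lemma convex_cone_hull_halfspace:
  fixes p :: "'a::real_inner"
  shows "(\<forall>y\<in>convex_cone hull S. 0 \<le> p \<bullet> y) \<longleftrightarrow> (\<forall>y\<in>S. 0 \<le> p \<bullet> y)"
proof
  assume "\<forall>y\<in>S. 0 \<le> p \<bullet> y"
  then have "convex_cone hull S \<subseteq> {y. p \<bullet> y \<ge> 0}"
    by (intro hull_minimal convex_cone_halfspace_ge) auto
  then show "\<forall>y\<in>convex_cone hull S. 0 \<le> p \<bullet> y" by auto
qed (auto simp: hull_inc)

lemma convex_cone_hull_annihilator:
  fixes p :: "'a::real_inner"
  shows "(\<forall>y\<in>convex_cone hull S. p \<bullet> y = 0) \<longleftrightarrow> (\<forall>y\<in>S. p \<bullet> y = 0)"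
  using convex_cone_hull_halfspace[of S p] convex_cone_hull_halfspace[of S "- p"]
  by (auto simp: inner_minus_left intro!: antisym)

lemma span_convex_cone_hull: "span (convex_cone hull S) = span S"
proof (rule subset_antisym)
  have "convex_cone hull S \<subseteq> span S"
    by (intro hull_minimal convex_cone_span) (auto simp: span_base)
  then show "span (convex_cone hull S) \<subseteq> span S"
    by (simp add: span_minimal)
qed (simp add: hull_subset span_mono)

text \<open>By this lemma a hyperplane that separates a cone from a point can be moved to the origin.\<close>

lemma convex_cone_bounded_below_imp_nonneg:
  fixes p :: "'a::real_inner"
  assumes "convex_cone C" and "\<And>y. y \<in> C \<Longrightarrow> b \<le> p \<bullet> y" and "y \<in> C"
  shows "0 \<le> p \<bullet> y"
proof (rule ccontr)
  assume "\<not> 0 \<le> p \<bullet> y"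
  then have neg: "p \<bullet> y < 0" by simp
  have "0 \<le> (\<bar>b\<bar> + 1) / - (p \<bullet> y)"
    using neg by (intro divide_nonneg_pos) auto
  then have "((\<bar>b\<bar> + 1) / - (p \<bullet> y)) *\<^sub>R y \<in> C"
    using assms(1,3) by (intro convex_cone_scaleR)
  then have "b \<le> p \<bullet> (((\<bar>b\<bar> + 1) / - (p \<bullet> y)) *\<^sub>R y)"
    by (rule assms(2))
  also have "\<dots> = - (\<bar>b\<bar> + 1)"
    using neg by simp
  finally show False by linarith
qed

text \<open>The bipolar theorem.\<close>

lemma closure_convex_cone_eq_bidual:
  fixes C :: "'a::euclidean_space set"
  assumes C: "convex_cone C"
  shows "closure C = {y. \<forall>p. (\<forall>z\<in>C. 0 \<le> p \<bullet> z) \<longrightarrow> 0 \<le> p \<bullet> y}"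
proof (intro subset_antisym subsetI CollectI allI impI)
  fix y p assume y: "y \<in> closure C" and p: "\<forall>z\<in>C. 0 \<le> p \<bullet> z"
  have "closure C \<subseteq> {z. p \<bullet> z \<ge> 0}"
    using p by (intro closure_minimal closed_halfspace_ge) auto
  then show "0 \<le> p \<bullet> y" using y by auto
next
  fix y assume y: "y \<in> {y. \<forall>p. (\<forall>z\<in>C. 0 \<le> p \<bullet> z) \<longrightarrow> 0 \<le> p \<bullet> y}"
  show "y \<in> closure C"
  proof (rule ccontr)
    assume "y \<notin> closure C"
    moreover have "convex (closure C)"
      using C by (simp add: convex_cone_def convex_closure)
    ultimately obtain p b where p: "p \<bullet> y < b" "\<And>z. z \<in> closure C \<Longrightarrow> b < p \<bullet> z"
      using separating_hyperplane_closed_point[of "closure C" y] by auto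
    have above: "b < p \<bullet> z" if "z \<in> C" for z
      using p(2) that closure_subset by blast
    then have "\<forall>z\<in>C. 0 \<le> p \<bullet> z"
      using convex_cone_bounded_below_imp_nonneg[OF C] by (meson less_imp_le)
    with y have "0 \<le> p \<bullet> y" by blast
    with p(1) above[OF convex_cone_contains_0[OF C]] show False by simp
  qed
qed

lemma rel_interior_convex_cone:
  fixes C :: "'a::euclidean_space set"
  assumes C: "convex_cone C"
  shows "rel_interior C =
    {y. \<forall>p. (\<forall>z\<in>C. 0 \<le> p \<bullet> z) \<longrightarrow> 0 \<le> p \<bullet> y \<and> (p \<bullet> y = 0 \<longrightarrow> (\<forall>z\<in>C. p \<bullet> z = 0))}"
    (is "_ = ?S")
proof (intro subset_antisym subsetI CollectI allI impI conjI ballI)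
  have conv: "convex C" using C by (simp add: convex_cone_def)
  {
    fix y p assume y: "y \<in> rel_interior C" and p: "\<forall>z\<in>C. 0 \<le> p \<bullet> z"
    show "0 \<le> p \<bullet> y"
      using y p rel_interior_subset by blast
    fix z assume eq: "p \<bullet> y = 0" and z: "z \<in> C"
    \<comment> \<open>The segment from \<open>z\<close> to \<open>y\<close> can be prolonged beyond \<open>y\<close> inside \<open>C\<close>.\<close>
    obtain m where "m > 1" and m: "(1 - m) *\<^sub>R z + m *\<^sub>R y \<in> C"
      using convex_rel_interior_if[OF conv y] hull_inc[OF z, of affine] by blast
    have "0 \<le> p \<bullet> ((1 - m) *\<^sub>R z + m *\<^sub>R y)"
      using p m by blast
    then have "0 \<le> (1 - m) * (p \<bullet> z)"
      using eq by (simp add: inner_add_right)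
    with \<open>m > 1\<close> have "p \<bullet> z \<le> 0"
      by (simp add: zero_le_mult_iff)
    with p z show "p \<bullet> z = 0" by force
  }
  fix y assume y: "y \<in> ?S"
  then have ycl: "y \<in> closure C"
    unfolding closure_convex_cone_eq_bidual[OF C] by blast
  show "y \<in> rel_interior C"
  proof (rule ccontr)
    assume "y \<notin> rel_interior C"
    then have "y \<notin> rel_interior (closure C)"
      by (simp add: convex_rel_interior_closure conv)
    then obtain p where ge: "\<And>z. z \<in> closure C \<Longrightarrow> p \<bullet> y \<le> p \<bullet> z"
      and gt: "\<And>z. z \<in> rel_interior (closure C) \<Longrightarrow> p \<bullet> y < p \<bullet> z"
      using supporting_hyperplane_rel_boundary[OF convex_closure[OF conv] ycl] by metis
    have nonneg: "\<forall>z\<in>C. 0 \<le> p \<bullet> z"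
      using convex_cone_bounded_below_imp_nonneg[OF C] ge closure_subset by blast
    have "0 \<in> C" using C by (rule convex_cone_contains_0)
    then have "p \<bullet> y \<le> 0"
      using ge[of 0] closure_subset by auto
    moreover have "0 \<le> p \<bullet> y \<and> (p \<bullet> y = 0 \<longrightarrow> (\<forall>z\<in>C. p \<bullet> z = 0))"
      using y nonneg by blast
    ultimately have py: "p \<bullet> y = 0" and vanish: "\<forall>z\<in>C. p \<bullet> z = 0" by simp_all
    obtain z where z: "z \<in> rel_interior C"
      using rel_interior_eq_empty[OF conv] \<open>0 \<in> C\<close> by blast
    then have "p \<bullet> y < p \<bullet> z"
      using gt by (simp add: convex_rel_interior_closure conv)
    moreover have "p \<bullet> z = 0"
      using vanish z rel_interior_subset by blast
    ultimately show False using py by simp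
  qed
qed

lemma rel_interior_between_convex_closure:
  fixes C :: "'a::euclidean_space set"
  assumes "convex C" and "C \<subseteq> R" and "R \<subseteq> closure C"
  shows "rel_interior R = rel_interior C"
proof -
  have aff: "affine hull R = affine hull C"
    using hull_mono[OF assms(2), of affine] hull_mono[OF assms(3), of affine] by simp
  have "rel_interior C \<subseteq> rel_interior R"
    using aff by (intro subset_rel_interior assms(2)) simp
  moreover have "rel_interior R \<subseteq> rel_interior (closure C)"
    using aff by (intro subset_rel_interior assms(3)) simp
  ultimately show ?thesis
    using assms(1) by (simp add: convex_rel_interior_closure)
qed

lemma closed_convex_cone_hull_compact:
  fixes S :: "'a::euclidean_space set"
  assumes "compact S" and q: "\<And>y. y \<in> S \<Longrightarrow> 0 < q \<bullet> y"
  shows "closed (convex_cone hull S)"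
proof (cases "S = {}")
  case False
  have "convex hull S \<subseteq> {y. q \<bullet> y > 0}"
    using q by (intro hull_minimal convex_halfspace_gt) auto
  then have "0 \<notin> convex hull S" by auto
  then have "closed (conic hull (convex hull S))"
    using assms(1) by (intro closed_conic_hull) (simp add: compact_convex_hull)
  then show ?thesis
    using convex_cone_hull_separate_nonempty[OF False] by simp
qed simp

lemma orthogonal_comp_span: "(span S)\<^sup>\<bottom> = {p. \<forall>z\<in>S. p \<bullet> z = 0}"
proof -
  have "(\<forall>z\<in>span S. z \<bullet> p = 0) \<longleftrightarrow> (\<forall>z\<in>S. p \<bullet> z = 0)" for p
  proof
    assume "\<forall>z\<in>span S. z \<bullet> p = 0"
    then show "\<forall>z\<in>S. p \<bullet> z = 0"
      by (metis inner_commute span_base)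
  next
    assume "\<forall>z\<in>S. p \<bullet> z = 0"
    then have "orthogonal p z" if "z \<in> span S" for z
      using that by (intro orthogonal_to_span[of z S p]) (auto simp: orthogonal_def)
    then show "\<forall>z\<in>span S. z \<bullet> p = 0"
      by (metis inner_commute orthogonal_def)
  qed
  then show ?thesis
    by (simp add: orthogonal_comp_def orthogonal_def)
qed

lemma span_eq_double_annihilator:
  fixes S :: "'a::euclidean_space set"
  shows "span S = {y. \<forall>p\<in>{p. \<forall>z\<in>S. p \<bullet> z = 0}. p \<bullet> y = 0}"
proof -
  have "span S = (span S)\<^sup>\<bottom>\<^sup>\<bottom>"
    by (simp add: orthogonal_comp_self)
  then show ?thesis
    unfolding orthogonal_comp_span by (simp add: orthogonal_comp_def orthogonal_def)
qed

lemma dim_annihilator: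
  fixes S :: "'a::euclidean_space set"
  shows "dim S + dim {p. \<forall>z\<in>S. p \<bullet> z = 0} = DIM('a)"
proof -
  have "{y \<in> UNIV. \<forall>x\<in>span S. orthogonal x y} = (span S)\<^sup>\<bottom>"
    by (auto simp: orthogonal_comp_def)
  then show ?thesis
    using dim_subspace_orthogonal_to_vectors[of "span S" "UNIV :: 'a set"]
    unfolding orthogonal_comp_span by simp
qed

lemma interior_dual_compact:
  fixes S :: "'a::euclidean_space set"
  assumes "compact S" and q: "\<And>y. y \<in> S \<Longrightarrow> 0 < q \<bullet> y"
  shows "interior {p. \<forall>y\<in>S. 0 \<le> p \<bullet> y} = {p. \<forall>y\<in>S. 0 < p \<bullet> y}"
proof (rule interior_unique)
  show "open {p. \<forall>y\<in>S. 0 < p \<bullet> y}"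
  proof (cases "S = {}")
    case False
    show ?thesis
    proof (rule openI)
      fix p assume p: "p \<in> {p. \<forall>y\<in>S. 0 < p \<bullet> y}"
      obtain y0 where y0: "y0 \<in> S" "\<And>y. y \<in> S \<Longrightarrow> p \<bullet> y0 \<le> p \<bullet> y"
        using continuous_attains_inf[OF assms(1) False, of "\<lambda>y. p \<bullet> y"]
          continuous_on_inner[OF continuous_on_const continuous_on_id] by blast
      obtain B where B: "B > 0" "\<And>y. y \<in> S \<Longrightarrow> norm y \<le> B"
        using compact_imp_bounded[OF assms(1)] by (auto simp: bounded_pos)
      have "p' \<in> {p. \<forall>y\<in>S. 0 < p \<bullet> y}" if "p' \<in> ball p ((p \<bullet> y0) / B)" for p'
      proof (intro CollectI ballI)
        fix y assume y: "y \<in> S"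
        have "\<bar>(p - p') \<bullet> y\<bar> \<le> norm (p - p') * norm y"
          by (rule Cauchy_Schwarz_ineq2)
        also have "\<dots> \<le> norm (p - p') * B"
          using B(2)[OF y] by (intro mult_left_mono) auto
        also have "\<dots> < p \<bullet> y0"
          using that B(1) by (simp add: dist_norm pos_less_divide_eq)
        also have "\<dots> \<le> p \<bullet> y" using y0 y by blast
        finally show "0 < p' \<bullet> y" by (simp add: inner_diff_left)
      qed
      then show "\<exists>\<epsilon>>0. ball p \<epsilon> \<subseteq> {p. \<forall>y\<in>S. 0 < p \<bullet> y}"
        using p y0(1) B(1) by (intro exI[of _ "(p \<bullet> y0) / B"]) auto
    qed
  qed simp
  fix T assume T: "T \<subseteq> {p. \<forall>y\<in>S. 0 \<le> p \<bullet> y}" "open T"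
  show "T \<subseteq> {p. \<forall>y\<in>S. 0 < p \<bullet> y}"
  proof (intro subsetI CollectI ballI)
    fix p y assume p: "p \<in> T" and y: "y \<in> S"
    obtain \<epsilon> where \<epsilon>: "\<epsilon> > 0" "cball p \<epsilon> \<subseteq> T"
      using T(2) p open_contains_cball by blast
    have "q \<noteq> 0" using q[OF y] by auto
    then have "p - (\<epsilon> / norm q) *\<^sub>R q \<in> cball p \<epsilon>"
      using \<epsilon>(1) by (simp add: dist_norm)
    then have "0 \<le> (p - (\<epsilon> / norm q) *\<^sub>R q) \<bullet> y"
      using T(1) \<epsilon>(2) y by blast
    then have "(\<epsilon> / norm q) * (q \<bullet> y) \<le> p \<bullet> y"
      by (simp add: inner_diff_left)
    moreover have "0 < (\<epsilon> / norm q) * (q \<bullet> y)"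
      using \<epsilon>(1) q[OF y] \<open>q \<noteq> 0\<close> by simp
    ultimately show "0 < p \<bullet> y" by linarith
  qed
qed (auto simp: less_imp_le)

section \<open>Monomial vectors and measures on a closed set\<close>

text \<open>The vector of all monomials of the set of powers, evaluated at a point.\<close>

definition moment_vector :: "('a::finite \<Rightarrow> 'n::finite exponent) \<Rightarrow> real ^ 'n \<Rightarrow> real ^ 'a" where
  "moment_vector e x = (\<chi> i. monomial (e i) x)"

lemma peval_eq_inner:
  assumes "inj e"
  shows "peval (poly_of e p) x = p \<bullet> moment_vector e x"
  using assms by (simp add: peval_poly_of moment_vector_def inner_vec_def)

lemma riesz_eq_inner: "riesz y p = p \<bullet> y"
  by (simp add: riesz_def inner_vec_def)

lemma continuous_on_monomial [continuous_intros]: "continuous_on S (monomial \<alpha>)"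
  unfolding monomial_def[abs_def] by (intro continuous_intros)

lemma continuous_on_moment_vector: "continuous_on S (moment_vector e)"
  unfolding moment_vector_def[abs_def] by (intro continuous_intros)

lemma borel_measurable_monomial [measurable]: "monomial \<alpha> \<in> borel_measurable borel"
  by (intro borel_measurable_continuous_onI continuous_on_monomial)

lemma closed_semialgebraic:
  fixes c :: "'l \<Rightarrow> 'n::finite mpoly"
  shows "closed (semialgebraic c E I)"
proof -
  have cont: "continuous_on UNIV (peval p)" for p :: "'n mpoly"
    unfolding peval_def[abs_def] by (intro continuous_intros)
  have "semialgebraic c E I =
      (\<Inter>i\<in>E. {x. peval (c i) x = 0}) \<inter> (\<Inter>j\<in>I. {x. 0 \<le> peval (c j) x})"
    by (auto simp: semialgebraic_def)
  then show ?thesis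
    by (auto intro!: closed_INT closed_Collect_eq closed_Collect_le cont continuous_intros)
qed

text \<open>In a second countable space a Borel measure vanishes outside its support.\<close>

lemma AE_in_measure_support:
  fixes \<mu> :: "'b::second_countable_topology measure"
  assumes "sets \<mu> = sets borel"
  shows "AE x in \<mu>. x \<in> measure_support \<mu>"
proof -
  define F where "F = {U. open U \<and> emeasure \<mu> U = 0}"
  obtain F' where F': "F' \<subseteq> F" "countable F'" "\<Union>F' = \<Union>F"
    using Lindelof[of F] by (auto simp: F_def)
  have "\<Union>F' \<in> null_sets \<mu>"
  proof -
    have "U \<in> null_sets \<mu>" if "U \<in> F'" for U
      using that F'(1) assms by (auto simp: F_def null_sets_def)
    then show ?thesis
      using null_sets_UN'[OF F'(2), of "\<lambda>U. U" \<mu>] by simp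
  qed
  moreover have "x \<in> \<Union>F'" if "x \<notin> measure_support \<mu>" for x
    using that unfolding F'(3) by (auto simp: measure_support_def F_def)
  ultimately show ?thesis
    by (auto intro!: AE_I')
qed

section \<open>The moment cone and the cone generated by the monomial vectors\<close>

lemma riesz_moment_cone_nonneg:
  assumes "y \<in> moment_cone e K" and p: "\<And>x. x \<in> K \<Longrightarrow> 0 \<le> p \<bullet> moment_vector e x"
  shows "0 \<le> p \<bullet> y"
proof -
  obtain \<mu> where sets: "sets \<mu> = sets borel" and supp: "measure_support \<mu> \<subseteq> K"
    and int: "\<And>i. integrable \<mu> (monomial (e i))" and y: "\<And>i. y $ i = (\<integral>x. monomial (e i) x \<partial>\<mu>)"
    using assms(1) by (auto simp: moment_cone_def representing_measure_def)
  have "p \<bullet> y = (\<Sum>i\<in>UNIV. \<integral>x. p $ i * monomial (e i) x \<partial>\<mu>)"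
    by (simp add: inner_vec_def y)
  also have "\<dots> = (\<integral>x. p \<bullet> moment_vector e x \<partial>\<mu>)"
    using int by (simp add: inner_vec_def moment_vector_def)
  also have "\<dots> \<ge> 0"
    using AE_in_measure_support[OF sets] supp p by (intro integral_nonneg_AE) auto
  finally show ?thesis .
qed

lemma moment_cone_subset_closure:
  "moment_cone e K \<subseteq> closure (convex_cone hull (moment_vector e ` K))"
  unfolding closure_convex_cone_eq_bidual[OF convex_cone_convex_cone_hull]
    convex_cone_hull_halfspace
  by (auto intro: riesz_moment_cone_nonneg)

lemma atomic_in_moment_cone:
  fixes e :: "'a::finite \<Rightarrow> 'n::finite exponent"
  assumes "closed K" and "finite S" and g: "\<And>v. v \<in> S \<Longrightarrow> g v \<in> K" and w: "\<And>v. v \<in> S \<Longrightarrow> 0 \<le> w v"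
  shows "(\<Sum>v\<in>S. w v *\<^sub>R moment_vector e (g v)) \<in> moment_cone e K"
proof -
  define \<mu> where "\<mu> = distr (point_measure S (\<lambda>v. ennreal (w v))) borel g"
  have meas: "g \<in> point_measure S (\<lambda>v. ennreal (w v)) \<rightarrow>\<^sub>M borel" by simp
  have "emeasure \<mu> (- K) = 0"
  proof -
    have "g -` (- K) \<inter> S = {}" using g by auto
    then show ?thesis
      using \<open>closed K\<close> by (simp add: \<mu>_def emeasure_distr[OF meas] space_point_measure)
  qed
  then have "x \<notin> measure_support \<mu>" if "x \<notin> K" for x
    using that \<open>closed K\<close> unfolding measure_support_def
    by (auto intro!: exI[of _ "- K"])
  then have "measure_support \<mu> \<subseteq> K" by blast
  moreover have "integrable \<mu> (monomial (e i))" for i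
    unfolding \<mu>_def using \<open>finite S\<close>
    by (subst integrable_distr_eq[OF meas]) (auto intro: integrable_point_measure_finite)
  moreover have "(\<integral>x. monomial (e i) x \<partial>\<mu>) = (\<Sum>v\<in>S. w v *\<^sub>R moment_vector e (g v)) $ i" for i
    unfolding \<mu>_def using \<open>finite S\<close> w
    by (subst integral_distr[OF meas])
      (auto simp: lebesgue_integral_point_measure_finite moment_vector_def)
  ultimately show ?thesis
    unfolding moment_cone_def representing_measure_def
    by (auto intro!: exI[of _ \<mu>] simp: \<mu>_def)
qed

lemma atomic_subset_moment_cone:
  assumes "closed K"
  shows "convex_cone hull (moment_vector e ` K) \<subseteq> moment_cone e K"
proof
  fix y assume "y \<in> convex_cone hull (moment_vector e ` K)"
  then consider "y = 0" | "y \<in> conic hull (convex hull (moment_vector e ` K))"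
    unfolding convex_cone_hull_separate by blast
  then show "y \<in> moment_cone e K"
  proof cases
    case 1
    then show ?thesis using atomic_in_moment_cone[OF assms, of "{}"] by simp
  next
    case 2
    then obtain c z where c: "0 \<le> c" and z: "z \<in> convex hull (moment_vector e ` K)"
      and y: "y = c *\<^sub>R z"
      by (auto simp: conic_hull_explicit)
    obtain S u where S: "finite S" "S \<subseteq> moment_vector e ` K" "\<forall>v\<in>S. 0 \<le> u v"
      and z: "z = (\<Sum>v\<in>S. u v *\<^sub>R v)"
      using z unfolding convex_hull_explicit by blast
    have "\<forall>v\<in>S. \<exists>x. x \<in> K \<and> moment_vector e x = v"
      using S(2) by auto
    then obtain g where g: "\<And>v. v \<in> S \<Longrightarrow> g v \<in> K" "\<And>v. v \<in> S \<Longrightarrow> moment_vector e (g v) = v"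
      by (auto dest!: bchoice)
    have "(\<Sum>v\<in>S. (c * u v) *\<^sub>R moment_vector e (g v)) \<in> moment_cone e K"
      using S c g(1) by (intro atomic_in_moment_cone assms) auto
    also have "(\<Sum>v\<in>S. (c * u v) *\<^sub>R moment_vector e (g v)) = y"
      using g(2) by (simp add: y z scaleR_sum_right)
    finally show ?thesis .
  qed
qed

section \<open>Duality, closedness, span and relative interior of the moment cone\<close>

theorem theorem3p1:
  fixes A :: "'n::finite exponent set"
    and e :: "'a::finite \<Rightarrow> 'n exponent"
    and d :: nat
    and c :: "'l \<Rightarrow> 'n mpoly"
    and E I :: "'l set"
    and K :: "(real ^ 'n) set"
  assumes "finite A"
    and "bij_betw e UNIV A"
    and "d = powers_degree A"
    and "finite E" and "finite I"
    and "K = semialgebraic c E I"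
  shows "dual_of_vectors (moment_cone e K) = nonneg_polys e K
    \<and> dual_of_polys (nonneg_polys e K) = closure (moment_cone e K)
    \<and> (compact K \<and> (\<exists>q. \<forall>x\<in>K. peval (poly_of e q) x > 0) \<longrightarrow>
         interior (nonneg_polys e K) = {p. \<forall>x\<in>K. peval (poly_of e p) x > 0}
         \<and> closed (moment_cone e K))
    \<and> span (moment_cone e K) = {y. \<forall>p\<in>vanishing_polys e K. riesz y p = 0}
    \<and> span (moment_cone e K) = annihilator_of_polys (vanishing_polys e K)
    \<and> aff_dim (moment_cone e K) = int (card A) - int (dim (vanishing_polys e K))
    \<and> rel_interior (moment_cone e K) = {y. strictly_positive e K (riesz y)}
    \<and> (vanishing_polys e K = {0} \<longrightarrow> interior (moment_cone e K) \<noteq> {})"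
proof -
  have inj: "inj e" and card: "card A = CARD('a)"
    using assms(2) by (auto simp: bij_betw_def card_image)
  have "closed K" using assms(6) by (simp add: closed_semialgebraic)
  let ?S = "moment_vector e ` K"
  define C where "C = convex_cone hull ?S"
  define R where "R = moment_cone e K"
  note peval = peval_eq_inner[OF inj]
  have C: "convex_cone C" and conv: "convex C"
    unfolding C_def by (simp_all add: convex_cone_convex_cone_hull convex_convex_cone_hull)
  have CR: "C \<subseteq> R" and RC: "R \<subseteq> closure C"
    unfolding C_def R_def
    by (simp_all add: atomic_subset_moment_cone \<open>closed K\<close> moment_cone_subset_closure)
  have nonneg: "nonneg_polys e K = {p. \<forall>z\<in>?S. 0 \<le> p \<bullet> z}"
    by (simp add: nonneg_polys_def peval)
  also have "\<dots> = {p. \<forall>z\<in>C. 0 \<le> p \<bullet> z}"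
    unfolding C_def convex_cone_hull_halfspace ..
  finally have nonneg_C: "nonneg_polys e K = {p. \<forall>z\<in>C. 0 \<le> p \<bullet> z}" .
  have vanish: "vanishing_polys e K = {p. \<forall>z\<in>?S. p \<bullet> z = 0}"
    by (simp add: vanishing_polys_def peval)
  have closure: "closure R = closure C"
    using CR RC by (intro subset_antisym) (simp_all add: closure_minimal closure_mono)
  have "closure C \<subseteq> span C"
    by (intro closure_minimal closed_span) (auto simp: span_base)
  then have "span R = span C"
    using CR RC by (intro subset_antisym) (simp_all add: span_minimal span_mono)
  then have span: "span R = span ?S"
    by (simp add: C_def span_convex_cone_hull)
  have "0 \<in> R" using CR convex_cone_contains_0[OF C] by blast
  have ri: "rel_interior R = rel_interior C"
    using conv CR RC by (rule rel_interior_between_convex_closure)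

  have "dual_of_vectors R = nonneg_polys e K"
  proof (intro subset_antisym subsetI)
    fix p assume "p \<in> dual_of_vectors R"
    then show "p \<in> nonneg_polys e K"
      using CR by (auto simp: dual_of_vectors_def riesz_eq_inner nonneg_C)
  next
    fix p assume "p \<in> nonneg_polys e K"
    then show "p \<in> dual_of_vectors R"
      by (auto simp: dual_of_vectors_def riesz_eq_inner nonneg R_def intro: riesz_moment_cone_nonneg)
  qed
  moreover have "dual_of_polys (nonneg_polys e K) = closure R"
    unfolding closure closure_convex_cone_eq_bidual[OF C]
    by (simp add: dual_of_polys_def riesz_eq_inner nonneg_C)
  moreover have "interior (nonneg_polys e K) = {p. \<forall>x\<in>K. peval (poly_of e p) x > 0} \<and> closed R"
    if "compact K" and q: "\<forall>x\<in>K. peval (poly_of e q) x > 0" for q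
  proof -
    have compact: "compact ?S"
      using \<open>compact K\<close> by (intro compact_continuous_image continuous_on_moment_vector)
    have pos: "\<And>y. y \<in> ?S \<Longrightarrow> 0 < q \<bullet> y"
      using q by (auto simp: peval)
    have "closed C"
      unfolding C_def using compact pos by (rule closed_convex_cone_hull_compact)
    then have "R = C"
      using CR RC by simp
    moreover have "interior (nonneg_polys e K) = {p. \<forall>y\<in>?S. 0 < p \<bullet> y}"
      unfolding nonneg using compact pos by (rule interior_dual_compact)
    ultimately show ?thesis
      using \<open>closed C\<close> by (simp add: peval)
  qed
  moreover have "span R = {y. \<forall>p\<in>vanishing_polys e K. riesz y p = 0}"
    unfolding span vanish riesz_eq_inner by (rule span_eq_double_annihilator)
  moreover from this have "span R = annihilator_of_polys (vanishing_polys e K)"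
    by (simp add: annihilator_of_polys_def)
  moreover have dim: "aff_dim R = int (card A) - int (dim (vanishing_polys e K))"
  proof -
    have "aff_dim R = int (dim R)"
      using \<open>0 \<in> R\<close> by (intro aff_dim_zero hull_inc)
    also have "dim R = dim ?S"
      using span by (metis dim_span)
    finally show ?thesis
      using dim_annihilator[of ?S] by (simp add: card vanish)
  qed
  moreover have "rel_interior R = {y. strictly_positive e K (riesz y)}"
  proof -
    have "(\<forall>z\<in>C. p \<bullet> z = 0) \<longleftrightarrow> (\<forall>x\<in>K. peval (poly_of e p) x = 0)" for p
      by (simp add: C_def convex_cone_hull_annihilator peval)
    then show ?thesis
      unfolding ri rel_interior_convex_cone[OF C]
      by (auto simp: strictly_positive_def riesz_eq_inner nonneg_C less_le)
  qed
  moreover have "interior R \<noteq> {}" if "vanishing_polys e K = {0}"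
  proof -
    have "aff_dim R = int DIM(real ^ 'a)"
      using dim that by (simp add: card)
    then have "interior R = rel_interior C"
      using ri by (metis interior_rel_interior)
    then show ?thesis
      using rel_interior_eq_empty[OF conv] convex_cone_contains_0[OF C] by auto
  qed
  ultimately show ?thesis
    unfolding R_def by blast
qed

end
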